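(* Let $n,m\ge 1$ and $0\le r\le m$ be integers and let $$\widehat{\mathcal M}_r^{\mathrm{tot}}=\{(A,Y)\in\mathbb R^{n\times m}\times\mathbb R^{m\times(m-r)}: AY=0,\ Y^\top Y=I_{m-r}\}.$$ For $(A,Y)\in\widehat{\mathcal M}_r^{\mathrm{tot}}$ let $P_{(A,Y)}$ denote the orthogonal projection onto the horizontal space $\mathcal H(A,Y)$. Then $P_{(A,Y)}$ is Lipschitz continuous with respect to $(A,Y)$, with Lipschitz constant no greater than $2(\sqrt n+\sqrt{m-r})$ in the Frobenius norm; that is, for all $(A,Y),(A',Y')\in\widehat{\mathcal M}_r^{\mathrm{tot}}$, $$\|P_{(A,Y)}-P_{(A',Y')}\|_F\le 2(\sqrt n+\sqrt{m-r})\,\bigl(\|A-A'\|_F+\|Y-Y'\|_F\bigr).$$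
   Context: The horizontal space at $(A,Y)\in\widehat{\mathcal M}_r^{\mathrm{tot}}$ is $$\mathcal H(A,Y)=T_{(A,Y)}\widehat{\mathcal M}_r^{\mathrm{tot}}\cap\{(\delta A,\delta Y)\in\mathbb R^{n\times m}\times\mathbb R^{m\times(m-r)}:(\delta Y)^\top Y=0\},$$ where the tangent space $T_{(A,Y)}\widehat{\mathcal M}_r^{\mathrm{tot}}$ is the nullspace of the linearized constraints: all $(\delta A,\delta Y)$ with $\delta A\,Y+A\,\delta Y=0$ and $(\delta Y)^\top Y+Y^\top\delta Y=0$. Equivalently, after stacking $\delta A$ and $\delta Y$ columnwise into a single vector in $\mathbb R^{nm+m(m-r)}$, $\mathcal H(A,Y)$ is the kernel of $$N=\begin{bmatrix}Y^\top\otimes I_n & I_{m-r}\otimes A\\ 0& I_{m-r}\otimes Y^\top\end{bmatrix}.$$ Orthogonality is with respect to the standard Euclidean inner product on $\mathbb R^{nm+m(m-r)}$ (the Frobenius inner product on pairs of matrices), $P_{(A,Y)}$ is viewed as a square matrix of size $nm+m(m-r)$, and $\|\cdot\|_F$ is the Frobenius norm. *)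

theory Defs
  imports Complex_Main "Jordan_Normal_Form.Matrix"
begin

(* Matrices with explicit carriers are used throughout, so that the case r = m, in which Y is an
   m x 0 matrix, is covered. *)

definition M_tot :: "nat \<Rightarrow> nat \<Rightarrow> nat \<Rightarrow> (real mat \<times> real mat) set" where
  "M_tot n m r = {(A, Y). A \<in> carrier_mat n m \<and> Y \<in> carrier_mat m (m - r) \<and>
     A * Y = 0\<^sub>m n (m - r) \<and> transpose_mat Y * Y = 1\<^sub>m (m - r)}"

definition tangent_space ::
  "nat \<Rightarrow> nat \<Rightarrow> nat \<Rightarrow> real mat \<Rightarrow> real mat \<Rightarrow> (real mat \<times> real mat) set" where
  "tangent_space n m r A Y =
     {(dA, dY). dA \<in> carrier_mat n m \<and> dY \<in> carrier_mat m (m - r) \<and>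
        dA * Y + A * dY = 0\<^sub>m n (m - r) \<and>
        transpose_mat dY * Y + transpose_mat Y * dY = 0\<^sub>m (m - r) (m - r)}"

definition horizontal_space ::
  "nat \<Rightarrow> nat \<Rightarrow> nat \<Rightarrow> real mat \<Rightarrow> real mat \<Rightarrow> (real mat \<times> real mat) set" where
  "horizontal_space n m r A Y = tangent_space n m r A Y \<inter>
     {(dA, dY). dA \<in> carrier_mat n m \<and> dY \<in> carrier_mat m (m - r) \<and>
        transpose_mat dY * Y = 0\<^sub>m (m - r) (m - r)}"

(* Columnwise stacking: entry (i, j) goes to position j * dim_row A + i. *)
definition stack_cols :: "real mat \<Rightarrow> real vec" where
  "stack_cols A = vec (dim_row A * dim_col A) (\<lambda>k. A $$ (k mod dim_row A, k div dim_row A))"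

definition stack_pair :: "real mat \<times> real mat \<Rightarrow> real vec" where
  "stack_pair = (\<lambda>(A, Y). stack_cols A @\<^sub>v stack_cols Y)"

definition is_orth_proj :: "nat \<Rightarrow> real vec set \<Rightarrow> real mat \<Rightarrow> bool" where
  "is_orth_proj d S P \<longleftrightarrow> P \<in> carrier_mat d d \<and>
     (\<forall>v \<in> carrier_vec d. P *\<^sub>v v \<in> S \<and> (\<forall>w \<in> S. (v - P *\<^sub>v v) \<bullet> w = 0))"

(* Meaningful when S is a linear subspace of R^d: such a P then exists and is unique. *)
definition orth_proj :: "nat \<Rightarrow> real vec set \<Rightarrow> real mat" where
  "orth_proj d S = (THE P. is_orth_proj d S P)"

definition horizontal_proj :: "nat \<Rightarrow> nat \<Rightarrow> nat \<Rightarrow> real mat \<Rightarrow> real mat \<Rightarrow> real mat" where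
  "horizontal_proj n m r A Y =
     orth_proj (n * m + m * (m - r)) (stack_pair ` horizontal_space n m r A Y)"

definition frob_norm :: "real mat \<Rightarrow> real" where
  "frob_norm A = sqrt (\<Sum>i<dim_row A. \<Sum>j<dim_col A. (A $$ (i, j))\<^sup>2)"

end

theory Submission
  imports Defs "Jordan_Normal_Form.Determinant"
begin

text \<open>
  Write \<open>k = m - r\<close>. The horizontal space is the kernel of the matrix \<open>N\<close> of the linearized
  constraints, with block rows \<open>[Y\<^sup>T \<otimes> I\<^sub>n, I\<^sub>k \<otimes> A]\<close> and \<open>[0, I\<^sub>k \<otimes> Y\<^sup>T]\<close>. The constraints
  \<open>Y\<^sup>T Y = I\<close> and \<open>A Y = 0\<close> make \<open>N N\<^sup>T\<close> block diagonal with blocks \<open>I\<^sub>k \<otimes> (I + A A\<^sup>T)\<close> and \<open>I\<close>, so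
  all singular values of \<open>N\<close> are at least 1, whatever the size of \<open>A\<close>. This is why the Lipschitz
  constant is uniform: the pseudoinverse \<open>B = N\<^sup>T (N N\<^sup>T)\<inverse>\<close> is a contraction, and \<open>I - P = B N\<close>
  for the projection \<open>P\<close> onto the kernel of \<open>N\<close>.

  For a second such matrix \<open>N'\<close>, with projection \<open>P'\<close>, the relation \<open>N' P' = 0\<close> gives
  \<open>(I - P) P' = B (N - N') P'\<close>. Both outer factors are contractions, so the Frobenius norm of
  \<open>(I - P) P'\<close> is at most that of \<open>N - N'\<close> (\<open>kernel_projection_gap\<close>). Since
  \<open>P - P' = P (I - P') - (I - P) P'\<close> and the two terms on the right are such products, up to
  transposition and exchange of \<open>N\<close> and \<open>N'\<close>, it follows that \<open>P - P'\<close> has norm at most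
  \<open>2 \<parallel>N - N'\<parallel>\<close> (\<open>kernel_projection_lipschitz\<close>).

  Finally \<open>N\<close> depends linearly on \<open>(A, Y)\<close>, and the Frobenius norm of a Kronecker product is the product of
  the norms, whence
  \<open>\<parallel>N - N'\<parallel>\<^sup>2 = n \<parallel>Y - Y'\<parallel>\<^sup>2 + k (\<parallel>A - A'\<parallel>\<^sup>2 + \<parallel>Y - Y'\<parallel>\<^sup>2)\<close>. This is at most the square of
  \<open>(\<surd>n + \<surd>k) (\<parallel>A - A'\<parallel> + \<parallel>Y - Y'\<parallel>)\<close>.
\<close>

section \<open>Contractions and the Frobenius norm\<close>

lemma real_scalar_prod_self_nonneg: "0 \<le> (x :: real vec) \<bullet> x"
  by (auto simp: scalar_prod_def intro: sum_nonneg)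

lemma real_scalar_prod_self_zero:
  fixes x :: "real vec"
  assumes "x \<in> carrier_vec n" "x \<bullet> x = 0"
  shows "x = 0\<^sub>v n"
proof
  fix i assume "i < dim_vec (0\<^sub>v n :: real vec)"
  then show "x $ i = 0\<^sub>v n $ i"
    using assms by (auto simp: scalar_prod_def sum_nonneg_eq_0_iff)
qed (use assms in auto)

lemma mat_mult_unit_vec:
  fixes M :: "real mat"
  assumes "M \<in> carrier_mat p q" "j < q"
  shows "M *\<^sub>v unit_vec q j = col M j"
  using assms by (intro eq_vecI) (auto simp: scalar_prod_right_unit[of _ q])

lemma zero_mat_mult_vec:
  fixes v :: "real vec"
  assumes "v \<in> carrier_vec q"
  shows "0\<^sub>m p q *\<^sub>v v = 0\<^sub>v p"
  using assms by (intro eq_vecI) auto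

lemma minus_zero_mat:
  fixes M :: "real mat"
  assumes "M \<in> carrier_mat p q"
  shows "M - 0\<^sub>m p q = M"
  using assms by (intro eq_matI) auto

lemma frob_norm_nonneg: "0 \<le> frob_norm A"
  by (auto simp: frob_norm_def intro!: sum_nonneg)

lemma frob_norm_power2:
  "(frob_norm A)\<^sup>2 = (\<Sum>i<dim_row A. \<Sum>j<dim_col A. (A $$ (i, j))\<^sup>2)"
  by (auto simp: frob_norm_def intro!: sum_nonneg)

lemma frob_norm_power2_cols:
  "(frob_norm A)\<^sup>2 = (\<Sum>j<dim_col A. col A j \<bullet> col A j)"
  unfolding frob_norm_power2
  by (subst sum.swap) (auto simp: scalar_prod_def power2_eq_square lessThan_atLeast0)

lemma frob_norm_transpose: "frob_norm (transpose_mat A) = frob_norm A"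
  unfolding frob_norm_def by (subst sum.swap) simp

text \<open>The squared Frobenius norm is the sum of the squared lengths of the columns, and \<open>C\<close> acts on
  each column separately.\<close>

lemma frob_norm_contraction_mult_le:
  fixes C M :: "real mat"
  assumes C: "C \<in> carrier_mat p q" and M: "M \<in> carrier_mat q s"
    and contr: "\<And>x. x \<in> carrier_vec q \<Longrightarrow> (C *\<^sub>v x) \<bullet> (C *\<^sub>v x) \<le> x \<bullet> x"
  shows "frob_norm (C * M) \<le> frob_norm M"
proof (rule power2_le_imp_le)
  have "col (C * M) j = C *\<^sub>v col M j" if "j < s" for j
    using that C M by (intro col_mult2)
  then show "(frob_norm (C * M))\<^sup>2 \<le> (frob_norm M)\<^sup>2"
    unfolding frob_norm_power2_cols using C M by (auto intro!: sum_mono contr)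
qed (rule frob_norm_nonneg)

lemma frob_norm_mult_contraction_le:
  fixes C M :: "real mat"
  assumes C: "C \<in> carrier_mat q s" and M: "M \<in> carrier_mat p q"
    and contr: "\<And>x. x \<in> carrier_vec q \<Longrightarrow>
      (transpose_mat C *\<^sub>v x) \<bullet> (transpose_mat C *\<^sub>v x) \<le> x \<bullet> x"
  shows "frob_norm (M * C) \<le> frob_norm M"
proof -
  have "transpose_mat (M * C) = transpose_mat C * transpose_mat M"
    by (rule transpose_mult[OF M C])
  moreover have "frob_norm (transpose_mat C * transpose_mat M) \<le> frob_norm (transpose_mat M)"
    using C M contr by (intro frob_norm_contraction_mult_le[of _ s q _ p]) auto
  ultimately show ?thesis
    by (metis frob_norm_transpose)
qed

section \<open>Orthogonal projections\<close>

text \<open>The vectors \<open>P v\<close> and \<open>Q v\<close> have the same inner product with every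
  element of \<open>S\<close>, in particular with \<open>P v\<close> and with \<open>Q v\<close>, so their difference is orthogonal to
  itself.\<close>

lemma is_orth_proj_unique:
  assumes P: "is_orth_proj d S P" and Q: "is_orth_proj d S Q" and S: "S \<subseteq> carrier_vec d"
  shows "P = Q"
proof -
  have c: "P \<in> carrier_mat d d" "Q \<in> carrier_mat d d"
    using P Q by (auto simp: is_orth_proj_def)
  have eq: "P *\<^sub>v v = Q *\<^sub>v v" if v: "v \<in> carrier_vec d" for v
  proof -
    have cv: "P *\<^sub>v v \<in> carrier_vec d" "Q *\<^sub>v v \<in> carrier_vec d"
      using c v by auto
    have same: "(P *\<^sub>v v) \<bullet> w = (Q *\<^sub>v v) \<bullet> w" if w: "w \<in> S" for w
    proof -
      have "(v - P *\<^sub>v v) \<bullet> w = 0" "(v - Q *\<^sub>v v) \<bullet> w = 0"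
        using P Q v w by (auto simp: is_orth_proj_def)
      moreover have "w \<in> carrier_vec d" using w S by auto
      ultimately show ?thesis
        using cv v by (simp add: minus_scalar_prod_distrib[of _ d])
    qed
    have "P *\<^sub>v v \<in> S" "Q *\<^sub>v v \<in> S"
      using P Q v by (auto simp: is_orth_proj_def)
    then have "(P *\<^sub>v v - Q *\<^sub>v v) \<bullet> (P *\<^sub>v v - Q *\<^sub>v v) = 0"
      using cv by (simp add: minus_scalar_prod_distrib[of _ d] scalar_prod_minus_distrib[of _ d] same)
    then have z: "P *\<^sub>v v - Q *\<^sub>v v = 0\<^sub>v d"
      using cv by (intro real_scalar_prod_self_zero) auto
    show ?thesis
    proof
      fix i assume i: "i < dim_vec (Q *\<^sub>v v)"
      have "(P *\<^sub>v v - Q *\<^sub>v v) $ i = 0"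
        using i c unfolding z by auto
      then show "(P *\<^sub>v v) $ i = (Q *\<^sub>v v) $ i"
        using i cv by auto
    qed (use c in auto)
  qed
  show ?thesis
  proof
    fix i j assume "i < dim_row Q" "j < dim_col Q"
    then have ij: "i < d" "j < d" using c by auto
    have "col P j = col Q j"
      using eq[of "unit_vec d j"] c ij by (simp add: mat_mult_unit_vec)
    then show "P $$ (i, j) = Q $$ (i, j)"
      using c ij by (metis carrier_matD index_col)
  qed (use c in auto)
qed

lemma orth_proj_eqI:
  assumes "is_orth_proj d S P" and "S \<subseteq> carrier_vec d"
  shows "orth_proj d S = P"
  unfolding orth_proj_def using assms is_orth_proj_unique by blast

text \<open>Both \<open>v \<bullet> P w\<close> and \<open>P v \<bullet> w\<close> equal \<open>P v \<bullet> P w\<close>.\<close>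

lemma orth_proj_self_adjoint:
  assumes P: "is_orth_proj d S P"
  shows "transpose_mat P = P"
proof -
  have c: "P \<in> carrier_mat d d"
    using P by (auto simp: is_orth_proj_def)
  have *: "v \<bullet> (P *\<^sub>v w) = (P *\<^sub>v v) \<bullet> (P *\<^sub>v w)"
    if "v \<in> carrier_vec d" "w \<in> carrier_vec d" for v w
  proof -
    have "(v - P *\<^sub>v v) \<bullet> (P *\<^sub>v w) = 0"
      using P that by (auto simp: is_orth_proj_def)
    then show ?thesis
      using c that by (simp add: minus_scalar_prod_distrib[of _ d])
  qed
  have **: "v \<bullet> (P *\<^sub>v w) = w \<bullet> (P *\<^sub>v v)"
    if "v \<in> carrier_vec d" "w \<in> carrier_vec d" for v w
    using *[OF that] *[OF that(2,1)] c that
    by (metis comm_scalar_prod mult_mat_vec_carrier)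
  show ?thesis
  proof
    fix i j assume "i < dim_row P" "j < dim_col P"
    then have ij: "i < d" "j < d" using c by auto
    have "unit_vec d i \<bullet> (P *\<^sub>v unit_vec d j) = P $$ (i, j)" if "i < d" "j < d" for i j
      using that c by (simp add: mat_mult_unit_vec scalar_prod_left_unit[of _ d])
    then show "transpose_mat P $$ (i, j) = P $$ (i, j)"
      using **[of "unit_vec d i" "unit_vec d j"] ij c by simp
  qed (use c in auto)
qed

text \<open>By Pythagoras, \<open>v \<bullet> v\<close> exceeds \<open>P v \<bullet> P v\<close> by the squared length of \<open>v - P v\<close>.\<close>

lemma orth_proj_contraction:
  assumes P: "is_orth_proj d S P" and v: "v \<in> carrier_vec d"
  shows "(P *\<^sub>v v) \<bullet> (P *\<^sub>v v) \<le> v \<bullet> v"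
proof -
  have c: "P *\<^sub>v v \<in> carrier_vec d"
    using P v by (auto simp: is_orth_proj_def)
  have "(v - P *\<^sub>v v) \<bullet> (P *\<^sub>v v) = 0"
    using P v by (auto simp: is_orth_proj_def)
  moreover have "0 \<le> (v - P *\<^sub>v v) \<bullet> (v - P *\<^sub>v v)"
    by (rule real_scalar_prod_self_nonneg)
  ultimately show ?thesis
    using c v comm_scalar_prod[OF c v]
    by (simp add: minus_scalar_prod_distrib[of _ d] scalar_prod_minus_distrib[of _ d])
qed

section \<open>Perturbation of the projection onto a kernel\<close>

definition kernel_vecs :: "real mat \<Rightarrow> real vec set" where
  "kernel_vecs N = {v \<in> carrier_vec (dim_col N). N *\<^sub>v v = 0\<^sub>v (dim_row N)}"

text \<open>The hypothesis \<open>coercive\<close>, here and below, says that every singular value of \<open>N\<close> is at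
  least 1 (and that the rows of \<open>N\<close> are independent). It makes the Gram matrix \<open>N N\<^sup>T\<close> injective: if
  \<open>N N\<^sup>T v = 0\<close>, then \<open>N\<^sup>T v\<close> has length 0, and therefore so has \<open>v\<close>.\<close>

lemma gram_inverse:
  fixes N :: "real mat"
  assumes N: "N \<in> carrier_mat p q"
    and coercive: "\<And>x. x \<in> carrier_vec p \<Longrightarrow>
      x \<bullet> x \<le> (transpose_mat N *\<^sub>v x) \<bullet> (transpose_mat N *\<^sub>v x)"
  obtains G where "G \<in> carrier_mat p p" "N * transpose_mat N * G = 1\<^sub>m p"
proof -
  let ?K = "N * transpose_mat N"
  have K: "?K \<in> carrier_mat p p" using N by auto
  have "det ?K \<noteq> 0"
  proof
    assume "det ?K = 0"
    then obtain v where v: "v \<in> carrier_vec p" "v \<noteq> 0\<^sub>v p" and 0: "?K *\<^sub>v v = 0\<^sub>v p"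
      using det_0_iff_vec_prod_zero_field[OF K] by auto
    let ?w = "transpose_mat N *\<^sub>v v"
    have w: "?w \<in> carrier_vec q" using N v by auto
    have "?w \<bullet> ?w = v \<bullet> (N *\<^sub>v ?w)"
      using transpose_vec_mult_scalar[OF N w v(1)] by simp
    also have "N *\<^sub>v ?w = ?K *\<^sub>v v"
      using N v by (metis assoc_mult_mat_vec transpose_carrier_mat)
    finally have "v \<bullet> v \<le> 0"
      using coercive[OF v(1)] 0 v by simp
    then have "v = 0\<^sub>v p"
      using real_scalar_prod_self_nonneg[of v] real_scalar_prod_self_zero[OF v(1)] by linarith
    then show False using v by simp
  qed
  from det_non_zero_imp_unit[OF K this, of "()"]
  show ?thesis
    using that unfolding Units_def ring_mat_def by auto
qed

lemma kernel_projection: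
  fixes N G :: "real mat"
  assumes N: "N \<in> carrier_mat p q" and G: "G \<in> carrier_mat p p"
    and inv: "N * transpose_mat N * G = 1\<^sub>m p"
  shows "is_orth_proj q (kernel_vecs N) (1\<^sub>m q - transpose_mat N * G * N)"
proof -
  let ?Q = "transpose_mat N * G * N"
  have Q: "?Q \<in> carrier_mat q q" using N G by auto
  have P: "(1\<^sub>m q - ?Q) *\<^sub>v v = v - ?Q *\<^sub>v v" if v: "v \<in> carrier_vec q" for v
    using minus_mult_distrib_mat_vec[OF one_carrier_mat Q v] v by simp
  have NQ: "N * ?Q = N"
  proof -
    have "N * ?Q = N * transpose_mat N * G * N"
      using assoc_mult_mat[OF N _ N, of "transpose_mat N * G"] assoc_mult_mat[OF N _ G] N G by simp
    then show ?thesis using inv N by simp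
  qed
  show ?thesis unfolding is_orth_proj_def
  proof (intro conjI ballI)
    show "1\<^sub>m q - ?Q \<in> carrier_mat q q" using Q by (rule minus_carrier_mat)
    fix v :: "real vec" assume v: "v \<in> carrier_vec q"
    have Qv: "?Q *\<^sub>v v \<in> carrier_vec q" using Q v by auto
    have "N *\<^sub>v (v - ?Q *\<^sub>v v) = N *\<^sub>v v - (N * ?Q) *\<^sub>v v"
      using mult_minus_distrib_mat_vec[OF N v Qv] assoc_mult_mat_vec[OF N Q v] by simp
    then show "(1\<^sub>m q - ?Q) *\<^sub>v v \<in> kernel_vecs N"
      using N v Qv by (simp add: P[OF v] NQ kernel_vecs_def)
    fix w assume "w \<in> kernel_vecs N"
    then have w: "w \<in> carrier_vec q" "N *\<^sub>v w = 0\<^sub>v p"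
      using N by (auto simp: kernel_vecs_def)
    let ?y = "G *\<^sub>v (N *\<^sub>v v)"
    have y: "?y \<in> carrier_vec p" using N G v by auto
    have TG: "transpose_mat N * G \<in> carrier_mat q p" using N G by auto
    have Nv: "N *\<^sub>v v \<in> carrier_vec p" using N v by auto
    have NT: "transpose_mat N \<in> carrier_mat q p" using N by auto
    have "?Q *\<^sub>v v = transpose_mat N *\<^sub>v ?y"
      using assoc_mult_mat_vec[OF TG N v] assoc_mult_mat_vec[OF NT G Nv] by simp
    then have "(?Q *\<^sub>v v) \<bullet> w = ?y \<bullet> (N *\<^sub>v w)"
      using transpose_vec_mult_scalar[OF N w(1) y] by simp
    also have "\<dots> = 0" using w y by simp
    finally show "(v - (1\<^sub>m q - ?Q) *\<^sub>v v) \<bullet> w = 0"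
      using v Qv w by (simp add: P[OF v] minus_scalar_prod_distrib[of _ q])
  qed
qed

text \<open>With \<open>y = G x\<close> one has \<open>N N\<^sup>T y = x\<close>, so the squared length of \<open>N\<^sup>T y\<close> is \<open>y \<bullet> x\<close>.
  Coercivity gives \<open>y \<bullet> y \<le> y \<bullet> x\<close>. Expanding \<open>0 \<le> (x - y) \<bullet> (x - y)\<close> then gives
  \<open>y \<bullet> x \<le> x \<bullet> x\<close>.\<close>

lemma pseudoinverse_contraction:
  fixes N G :: "real mat"
  assumes N: "N \<in> carrier_mat p q" and G: "G \<in> carrier_mat p p"
    and inv: "N * transpose_mat N * G = 1\<^sub>m p"
    and coercive: "\<And>x. x \<in> carrier_vec p \<Longrightarrow>
      x \<bullet> x \<le> (transpose_mat N *\<^sub>v x) \<bullet> (transpose_mat N *\<^sub>v x)"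
    and x: "x \<in> carrier_vec p"
  shows "((transpose_mat N * G) *\<^sub>v x) \<bullet> ((transpose_mat N * G) *\<^sub>v x) \<le> x \<bullet> x"
proof -
  define y where "y = G *\<^sub>v x"
  have y: "y \<in> carrier_vec p" using G x by (auto simp: y_def)
  have NT: "transpose_mat N \<in> carrier_mat q p" using N by auto
  have NNT: "N * transpose_mat N \<in> carrier_mat p p" using N by auto
  let ?w = "transpose_mat N *\<^sub>v y"
  have w: "?w \<in> carrier_vec q" using NT y by auto
  have "N *\<^sub>v ?w = (N * transpose_mat N * G) *\<^sub>v x"
    using assoc_mult_mat_vec[OF N NT y] assoc_mult_mat_vec[OF NNT G x] by (simp add: y_def)
  then have "N *\<^sub>v ?w = x" using inv x by simp
  then have ww: "?w \<bullet> ?w = y \<bullet> x"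
    using transpose_vec_mult_scalar[OF N w y] by simp
  have "0 \<le> (x - y) \<bullet> (x - y)" by (rule real_scalar_prod_self_nonneg)
  then have "2 * (y \<bullet> x) \<le> x \<bullet> x + y \<bullet> y"
    using x y comm_scalar_prod[OF x y]
    by (simp add: minus_scalar_prod_distrib[of _ p] scalar_prod_minus_distrib[of _ p])
  with ww coercive[OF y] have "?w \<bullet> ?w \<le> x \<bullet> x" by linarith
  moreover have "(transpose_mat N * G) *\<^sub>v x = ?w"
    using assoc_mult_mat_vec[OF NT G x] by (simp add: y_def)
  ultimately show ?thesis by simp
qed

text \<open>The matrix on the left is \<open>(I - P) P' = B N P' = B (N - N') P'\<close> with
  \<open>B = N\<^sup>T (N N\<^sup>T)\<inverse>\<close>; the last step uses \<open>N' P' = 0\<close>. Both \<open>B\<close> and \<open>P'\<close> are contractions.\<close>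

lemma kernel_projection_gap:
  fixes N N' :: "real mat"
  assumes N: "N \<in> carrier_mat p q" and N': "N' \<in> carrier_mat p q"
    and coercive: "\<And>x. x \<in> carrier_vec p \<Longrightarrow>
      x \<bullet> x \<le> (transpose_mat N *\<^sub>v x) \<bullet> (transpose_mat N *\<^sub>v x)"
    and P: "is_orth_proj q (kernel_vecs N) P" and P': "is_orth_proj q (kernel_vecs N') P'"
  shows "frob_norm (P' - P * P') \<le> frob_norm (N - N')"
proof -
  obtain G where G: "G \<in> carrier_mat p p" and inv: "N * transpose_mat N * G = 1\<^sub>m p"
    using gram_inverse[OF N coercive] by blast
  let ?B = "transpose_mat N * G"
  have B: "?B \<in> carrier_mat q p" using N G by auto
  have c: "P' \<in> carrier_mat q q" using P' by (auto simp: is_orth_proj_def)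
  have P_eq: "P = 1\<^sub>m q - ?B * N"
    using is_orth_proj_unique[OF P kernel_projection[OF N G inv]] N by (auto simp: kernel_vecs_def)
  have "N' * P' = 0\<^sub>m p q"
  proof
    fix i j assume "i < dim_row (0\<^sub>m p q :: real mat)" "j < dim_col (0\<^sub>m p q :: real mat)"
    then have ij: "i < p" "j < q" by auto
    have "P' *\<^sub>v unit_vec q j \<in> kernel_vecs N'"
      using P' by (auto simp: is_orth_proj_def)
    then have "N' *\<^sub>v col P' j = 0\<^sub>v p"
      using N' c ij by (simp add: kernel_vecs_def mat_mult_unit_vec)
    then have "col (N' * P') j = 0\<^sub>v p"
      using col_mult2[OF N' c ij(2)] by simp
    then show "(N' * P') $$ (i, j) = 0\<^sub>m p q $$ (i, j)"
      using N' c ij by (metis carrier_matD index_col index_mult_mat(2,3) index_zero_mat(1) index_zero_vec(1))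
  qed (use N' c in auto)
  moreover have NP: "N * P' \<in> carrier_mat p q" using N c by auto
  ultimately have diff: "(N - N') * P' = N * P'"
    using minus_mult_distrib_mat[OF N N' c] minus_zero_mat by simp
  have BN: "?B * N \<in> carrier_mat q q" using B N by auto
  have "P * P' = P' - ?B * N * P'"
    using minus_mult_distrib_mat[OF one_carrier_mat BN c] c by (simp add: P_eq)
  moreover have "?B * N * P' = ?B * (N * P')"
    using B N c by (rule assoc_mult_mat)
  moreover have BNP: "?B * (N * P') \<in> carrier_mat q q" using B NP by auto
  ultimately have "P' - P * P' = ?B * ((N - N') * P')"
    using c diff by (auto intro!: eq_matI)
  also have "frob_norm \<dots> \<le> frob_norm ((N - N') * P')"
    using pseudoinverse_contraction[OF N G inv coercive] NP diff
    by (intro frob_norm_contraction_mult_le[OF B, of _ q]) auto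
  also have "\<dots> \<le> frob_norm (N - N')"
    using orth_proj_contraction[OF P'] N N'
    by (intro frob_norm_mult_contraction_le[OF c, of _ p]) (auto simp: orth_proj_self_adjoint[OF P'])
  finally show ?thesis .
qed

text \<open>The difference \<open>P - P'\<close> splits as \<open>P (I - P') - (I - P) P'\<close>, and the gap lemma bounds both
  terms. The entrywise inequality \<open>(a - b)\<^sup>2 \<le> 2 a\<^sup>2 + 2 b\<^sup>2\<close> serves as triangle inequality, without
  loss because the two bounds are equal.\<close>

lemma kernel_projection_lipschitz:
  fixes N N' :: "real mat"
  assumes N: "N \<in> carrier_mat p q" and N': "N' \<in> carrier_mat p q"
    and coercive: "\<And>x. x \<in> carrier_vec p \<Longrightarrow>
      x \<bullet> x \<le> (transpose_mat N *\<^sub>v x) \<bullet> (transpose_mat N *\<^sub>v x)"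
    and coercive': "\<And>x. x \<in> carrier_vec p \<Longrightarrow>
      x \<bullet> x \<le> (transpose_mat N' *\<^sub>v x) \<bullet> (transpose_mat N' *\<^sub>v x)"
  shows "frob_norm (orth_proj q (kernel_vecs N) - orth_proj q (kernel_vecs N'))
    \<le> 2 * frob_norm (N - N')"
proof -
  have ex: "is_orth_proj q (kernel_vecs M) (orth_proj q (kernel_vecs M))"
    if M: "M \<in> carrier_mat p q" and co: "\<And>x. x \<in> carrier_vec p \<Longrightarrow>
      x \<bullet> x \<le> (transpose_mat M *\<^sub>v x) \<bullet> (transpose_mat M *\<^sub>v x)" for M
  proof -
    obtain G where G: "G \<in> carrier_mat p p" "M * transpose_mat M * G = 1\<^sub>m p"
      using gram_inverse[OF M co] by blast
    have "kernel_vecs M \<subseteq> carrier_vec q" using M by (auto simp: kernel_vecs_def)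
    then show ?thesis
      using kernel_projection[OF M G] orth_proj_eqI by metis
  qed
  define P where "P = orth_proj q (kernel_vecs N)"
  define P' where "P' = orth_proj q (kernel_vecs N')"
  have P: "is_orth_proj q (kernel_vecs N) P" and P': "is_orth_proj q (kernel_vecs N') P'"
    unfolding P_def P'_def using N N' coercive coercive' by (auto intro!: ex)
  have c: "P \<in> carrier_mat q q" "P' \<in> carrier_mat q q"
    using P P' by (auto simp: is_orth_proj_def)
  \<comment> \<open>\<open>X = (I - P) P'\<close> and \<open>Z = P (I - P')\<close>; the transpose turns \<open>Z\<close> into an instance of
    the gap lemma with the roles of \<open>N\<close> and \<open>N'\<close> exchanged.\<close>
  define X where "X = P' - P * P'"
  define Z where "Z = transpose_mat (P - P' * P)"
  have X: "X \<in> carrier_mat q q" and Z: "Z \<in> carrier_mat q q"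
    using c by (auto simp: X_def Z_def)
  have "transpose_mat (P' * P) = P * P'"
    using transpose_mult[OF c(2,1)] orth_proj_self_adjoint[OF P] orth_proj_self_adjoint[OF P']
    by simp
  then have "Z = P - P * P'"
    using c orth_proj_self_adjoint[OF P] by (simp add: Z_def transpose_minus)
  then have diff: "P - P' = Z - X"
    using c by (auto simp: X_def intro!: eq_matI)
  have bX: "frob_norm X \<le> frob_norm (N - N')"
    unfolding X_def by (rule kernel_projection_gap[OF N N' coercive P P'])
  have "frob_norm Z \<le> frob_norm (N' - N)"
    unfolding Z_def frob_norm_transpose
    by (rule kernel_projection_gap[OF N' N coercive' P' P])
  also have "frob_norm (N' - N) = frob_norm (N - N')"
    using N N' by (auto simp: frob_norm_def power2_commute)
  finally have bZ: "frob_norm Z \<le> frob_norm (N - N')" .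
  have "(frob_norm (Z - X))\<^sup>2 \<le> (\<Sum>i<q. \<Sum>j<q. 2 * (Z $$ (i,j))\<^sup>2 + 2 * (X $$ (i,j))\<^sup>2)"
  proof -
    have "(a - b)\<^sup>2 \<le> 2 * a\<^sup>2 + 2 * b\<^sup>2" for a b :: real
      using zero_le_power2[of "a + b"] by (simp add: power2_eq_square algebra_simps)
    then show ?thesis
      unfolding frob_norm_power2 using X Z by (auto intro!: sum_mono)
  qed
  also have "\<dots> = 2 * (frob_norm Z)\<^sup>2 + 2 * (frob_norm X)\<^sup>2"
    unfolding frob_norm_power2 using X Z by (simp add: sum.distrib sum_distrib_left)
  also have "\<dots> \<le> 2 * (frob_norm (N - N'))\<^sup>2 + 2 * (frob_norm (N - N'))\<^sup>2"
    using bX bZ by (intro add_mono mult_left_mono power_mono) (auto simp: frob_norm_nonneg)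
  also have "\<dots> = (2 * frob_norm (N - N'))\<^sup>2"
    by (simp add: power2_eq_square)
  finally have "frob_norm (Z - X) \<le> 2 * frob_norm (N - N')"
    by (rule power2_le_imp_le) (simp add: frob_norm_nonneg)
  then show ?thesis
    using diff by (simp add: P_def P'_def)
qed

section \<open>Kronecker products\<close>

definition kron :: "real mat \<Rightarrow> real mat \<Rightarrow> real mat" where
  "kron A B = mat (dim_row A * dim_row B) (dim_col A * dim_col B)
     (\<lambda>(i, j). A $$ (i div dim_row B, j div dim_col B) * B $$ (i mod dim_row B, j mod dim_col B))"

lemma div_mod_bounds:
  fixes i a b :: nat
  assumes "i < a * b"
  shows "i div b < a" "i mod b < b"
  using assms by (auto simp: less_mult_imp_div_less)
    (metis mod_less_divisor mult_0_right gr0I not_less0)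

text \<open>Row and column indices of a Kronecker product are pairs, coded by quotient and remainder; this
  turns a sum over codes into a double sum.\<close>

lemma sum_div_mod:
  fixes f :: "nat \<Rightarrow> nat \<Rightarrow> real"
  shows "(\<Sum>l<a * b. f (l div b) (l mod b)) = (\<Sum>i<a. \<Sum>j<b. f i j)"
proof -
  have "(\<Sum>l<a * b. f (l div b) (l mod b)) =
      (\<Sum>i<a. \<Sum>l\<in>{i * b..<i * b + b}. f (l div b) (l mod b))"
    by (rule sum.nat_group[symmetric])
  also have "\<dots> = (\<Sum>i<a. \<Sum>j<b. f i j)"
  proof (rule sum.cong[OF refl])
    fix i
    have "(\<Sum>l\<in>{i * b..<i * b + b}. f (l div b) (l mod b)) =
        (\<Sum>j\<in>{0..<b}. f ((j + i * b) div b) ((j + i * b) mod b))"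
      using sum.shift_bounds_nat_ivl[of "\<lambda>l. f (l div b) (l mod b)" 0 "i * b" b]
      by (simp add: add.commute)
    also have "\<dots> = (\<Sum>j<b. f i j)"
      by (auto simp: lessThan_atLeast0 intro!: sum.cong)
    finally show "(\<Sum>l\<in>{i * b..<i * b + b}. f (l div b) (l mod b)) = (\<Sum>j<b. f i j)" .
  qed
  finally show ?thesis .
qed

lemma kron_carrier:
  assumes "A \<in> carrier_mat a b" "B \<in> carrier_mat c d"
  shows "kron A B \<in> carrier_mat (a * c) (b * d)"
  using assms by (auto simp: kron_def)

lemma kron_mult:
  assumes A: "A \<in> carrier_mat a b" and B: "B \<in> carrier_mat c d"
    and C: "C \<in> carrier_mat b e" and D: "D \<in> carrier_mat d f"
  shows "kron A B * kron C D = kron (A * C) (B * D)"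
proof
  fix i j assume "i < dim_row (kron (A * C) (B * D))" "j < dim_col (kron (A * C) (B * D))"
  then have ij: "i < a * c" "j < e * f" using A B C D by (auto simp: kron_def)
  note bd = div_mod_bounds[OF ij(1)] div_mod_bounds[OF ij(2)]
  have "(kron A B * kron C D) $$ (i, j) =
      (\<Sum>l<b * d. (A $$ (i div c, l div d) * C $$ (l div d, j div f)) *
        (B $$ (i mod c, l mod d) * D $$ (l mod d, j mod f)))"
    using ij A B C D by (auto simp: kron_def scalar_prod_def lessThan_atLeast0 intro!: sum.cong)
  also have "\<dots> = (\<Sum>k<b. \<Sum>l<d. (A $$ (i div c, k) * C $$ (k, j div f)) *
        (B $$ (i mod c, l) * D $$ (l, j mod f)))"
    by (rule sum_div_mod)
  also have "\<dots> = kron (A * C) (B * D) $$ (i, j)"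
    using ij bd A B C D by (simp add: kron_def scalar_prod_def lessThan_atLeast0 sum_product)
  finally show "(kron A B * kron C D) $$ (i, j) = kron (A * C) (B * D) $$ (i, j)" .
qed (use assms in \<open>auto simp: kron_def\<close>)

lemma kron_transpose: "transpose_mat (kron A B) = kron (transpose_mat A) (transpose_mat B)"
  by (rule eq_matI) (auto simp: kron_def div_mod_bounds)

lemma kron_one: "kron (1\<^sub>m a) (1\<^sub>m b) = 1\<^sub>m (a * b)"
proof
  fix i j assume "i < dim_row (1\<^sub>m (a * b) :: real mat)" "j < dim_col (1\<^sub>m (a * b) :: real mat)"
  then have ij: "i < a * b" "j < a * b" by auto
  have "i = j \<longleftrightarrow> i div b = j div b \<and> i mod b = j mod b"
    by (metis div_mult_mod_eq)
  then show "kron (1\<^sub>m a) (1\<^sub>m b) $$ (i, j) = 1\<^sub>m (a * b) $$ (i, j)"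
    using ij div_mod_bounds[OF ij(1)] div_mod_bounds[OF ij(2)] by (auto simp: kron_def)
qed (auto simp: kron_def)

lemma kron_zero_right:
  assumes "A \<in> carrier_mat a b"
  shows "kron A (0\<^sub>m c d) = 0\<^sub>m (a * c) (b * d)"
  using assms by (intro eq_matI) (auto simp: kron_def div_mod_bounds)

lemma kron_minus_left:
  assumes "A \<in> carrier_mat a b" "A' \<in> carrier_mat a b"
  shows "kron (A - A') B = kron A B - kron A' B"
  using assms by (intro eq_matI) (auto simp: kron_def div_mod_bounds algebra_simps)

lemma kron_minus_right:
  assumes "B \<in> carrier_mat a b" "B' \<in> carrier_mat a b"
  shows "kron A (B - B') = kron A B - kron A B'"
  using assms by (intro eq_matI) (auto simp: kron_def div_mod_bounds algebra_simps)

lemma frob_norm_kron: "(frob_norm (kron A B))\<^sup>2 = (frob_norm A)\<^sup>2 * (frob_norm B)\<^sup>2"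
proof -
  let ?a = "dim_row A" and ?b = "dim_col A" and ?c = "dim_row B" and ?d = "dim_col B"
  have "(frob_norm (kron A B))\<^sup>2 = (\<Sum>i<?a * ?c. \<Sum>j<?b * ?d.
      (A $$ (i div ?c, j div ?d) * B $$ (i mod ?c, j mod ?d))\<^sup>2)"
    unfolding frob_norm_power2 by (auto simp: kron_def)
  also have "\<dots> = (\<Sum>i<?a * ?c. \<Sum>k<?b. \<Sum>l<?d.
      (A $$ (i div ?c, k) * B $$ (i mod ?c, l))\<^sup>2)"
    by (subst sum_div_mod) simp
  also have "\<dots> = (\<Sum>i<?a. \<Sum>j<?c. \<Sum>k<?b. \<Sum>l<?d. (A $$ (i, k) * B $$ (j, l))\<^sup>2)"
    by (rule sum_div_mod)
  also have "\<dots> = (frob_norm A)\<^sup>2 * (frob_norm B)\<^sup>2"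
    unfolding frob_norm_power2 by (simp add: sum_product power_mult_distrib)
  finally show ?thesis .
qed

lemma frob_norm_one: "(frob_norm (1\<^sub>m k))\<^sup>2 = real k"
proof -
  have "(\<Sum>j<k. (1\<^sub>m k $$ (i, j) :: real)\<^sup>2) = 1" if "i < k" for i
  proof -
    have "(\<Sum>j<k. (1\<^sub>m k $$ (i, j) :: real)\<^sup>2) = (\<Sum>j<k. if i = j then 1 else 0)"
      using that by (intro sum.cong) auto
    also have "\<dots> = 1" using that by simp
    finally show ?thesis .
  qed
  then show ?thesis by (simp add: frob_norm_power2)
qed

lemma stack_cols_carrier:
  assumes "X \<in> carrier_mat a b"
  shows "stack_cols X \<in> carrier_vec (a * b)"
  using assms by (auto simp: stack_cols_def)

lemma stack_cols_add:
  assumes "X \<in> carrier_mat a b" "Z \<in> carrier_mat a b"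
  shows "stack_cols (X + Z) = stack_cols X + stack_cols Z"
  using assms by (intro eq_vecI) (auto simp: stack_cols_def div_mod_bounds mult.commute)

lemma stack_cols_unstack:
  fixes v :: "real vec"
  assumes "v \<in> carrier_vec (a * b)"
  obtains X where "X \<in> carrier_mat a b" "stack_cols X = v"
proof
  let ?X = "mat a b (\<lambda>(i, j). v $ (j * a + i))"
  show "stack_cols ?X = v"
  proof
    fix i assume "i < dim_vec v"
    then have "i < b * a" using assms by (simp add: mult.commute)
    from div_mod_bounds[OF this] this show "stack_cols ?X $ i = v $ i"
      by (simp add: stack_cols_def mult.commute)
  qed (use assms in \<open>auto simp: stack_cols_def\<close>)
qed auto

lemma stack_cols_eq_zero_iff:
  assumes X: "X \<in> carrier_mat a b"
  shows "stack_cols X = 0\<^sub>v (a * b) \<longleftrightarrow> X = 0\<^sub>m a b"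
proof
  assume 0: "stack_cols X = 0\<^sub>v (a * b)"
  show "X = 0\<^sub>m a b"
  proof
    fix i j assume "i < dim_row (0\<^sub>m a b :: real mat)" "j < dim_col (0\<^sub>m a b :: real mat)"
    then have ij: "i < a" "j < b" by auto
    have "j * a + i < Suc j * a" using ij by simp
    also have "\<dots> \<le> b * a" using ij by (intro mult_le_mono1) simp
    finally have "j * a + i < a * b" by (simp add: mult.commute)
    moreover from this have "stack_cols X $ (j * a + i) = X $$ (i, j)"
      using X ij by (simp add: stack_cols_def)
    ultimately show "X $$ (i, j) = 0\<^sub>m a b $$ (i, j)"
      using 0 ij by simp
  qed (use X in auto)
next
  assume "X = 0\<^sub>m a b"
  then show "stack_cols X = 0\<^sub>v (a * b)"
    by (auto simp: stack_cols_def div_mod_bounds mult.commute)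
qed

text \<open>The identity \<open>(B\<^sup>T \<otimes> A) vec X = vec (A X B)\<close> writes linear equations between matrices as
  equations between stacked vectors.\<close>

lemma kron_mult_stack_cols:
  assumes A: "A \<in> carrier_mat a b" and X: "X \<in> carrier_mat b c" and B: "B \<in> carrier_mat c d"
  shows "kron (transpose_mat B) A *\<^sub>v stack_cols X = stack_cols (A * X * B)"
proof
  fix i assume "i < dim_vec (stack_cols (A * X * B))"
  then have i: "i < d * a" using A X B by (simp add: stack_cols_def mult.commute)
  note bd = div_mod_bounds[OF i]
  have "(kron (transpose_mat B) A *\<^sub>v stack_cols X) $ i =
      (\<Sum>l<c * b. B $$ (l div b, i div a) * A $$ (i mod a, l mod b) * X $$ (l mod b, l div b))"
    using i bd A X B
    by (auto simp: kron_def stack_cols_def scalar_prod_def lessThan_atLeast0 mult.commute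
        div_mod_bounds intro!: sum.cong)
  also have "\<dots> = (\<Sum>k<c. \<Sum>l<b. B $$ (k, i div a) * A $$ (i mod a, l) * X $$ (l, k))"
    by (rule sum_div_mod)
  also have "\<dots> = stack_cols (A * X * B) $ i"
    using i bd A X B
    by (simp add: stack_cols_def scalar_prod_def lessThan_atLeast0 mult.commute
        sum_distrib_left sum_distrib_right mult.left_commute sum.swap[of _ "{0..<c}" "{0..<b}"])
  finally show "(kron (transpose_mat B) A *\<^sub>v stack_cols X) $ i = stack_cols (A * X * B) $ i" .
qed (use assms in \<open>auto simp: kron_def stack_cols_def\<close>)

section \<open>The linearized constraints\<close>

definition constraint_mat :: "real mat \<Rightarrow> real mat \<Rightarrow> real mat" where
  "constraint_mat A Y = (let n = dim_row A; m = dim_row Y; k = dim_col Y in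
     four_block_mat (kron (transpose_mat Y) (1\<^sub>m n)) (kron (1\<^sub>m k) A)
       (0\<^sub>m (k * k) (m * n)) (kron (1\<^sub>m k) (transpose_mat Y)))"

lemma constraint_mat_carrier:
  assumes "A \<in> carrier_mat n m" "Y \<in> carrier_mat m k"
  shows "constraint_mat A Y \<in> carrier_mat (k * n + k * k) (m * n + k * m)"
  using assms by (auto simp: constraint_mat_def Let_def kron_def)

text \<open>The tangent equation \<open>dY\<^sup>T Y + Y\<^sup>T dY = 0\<close> follows from the horizontality condition
  \<open>dY\<^sup>T Y = 0\<close>, whose transpose is the second block row, \<open>Y\<^sup>T dY = 0\<close>.\<close>

lemma constraint_mat_kernel:
  assumes A: "A \<in> carrier_mat n m" and Y: "Y \<in> carrier_mat m (m - r)"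
  shows "stack_pair ` horizontal_space n m r A Y = kernel_vecs (constraint_mat A Y)"
proof -
  let ?k = "m - r"
  let ?N = "constraint_mat A Y"
  have key: "?N *\<^sub>v stack_pair (dA, dY) = 0\<^sub>v (?k * n + ?k * ?k) \<longleftrightarrow>
      (dA, dY) \<in> horizontal_space n m r A Y"
    if dA: "dA \<in> carrier_mat n m" and dY: "dY \<in> carrier_mat m ?k" for dA dY
  proof -
    let ?D = "kron (transpose_mat Y) (1\<^sub>m n)" and ?E = "kron (1\<^sub>m ?k) A"
      and ?F = "kron (1\<^sub>m ?k) (transpose_mat Y)"
    have D: "?D \<in> carrier_mat (?k * n) (m * n)" and E: "?E \<in> carrier_mat (?k * n) (?k * m)"
      and F: "?F \<in> carrier_mat (?k * ?k) (?k * m)"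
      using A Y by (auto intro!: kron_carrier)
    have vA: "stack_cols dA \<in> carrier_vec (m * n)" and vY: "stack_cols dY \<in> carrier_vec (?k * m)"
      using stack_cols_carrier[OF dA] stack_cols_carrier[OF dY] by (auto simp: mult.commute)
    have cY: "dA * Y \<in> carrier_mat n ?k" "A * dY \<in> carrier_mat n ?k"
      using A Y dA dY by auto
    have s: "dA * Y + A * dY \<in> carrier_mat n ?k" and t: "transpose_mat Y * dY \<in> carrier_mat ?k ?k"
      using A Y dA dY by auto
    have "?D *\<^sub>v stack_cols dA = stack_cols (dA * Y)"
      using kron_mult_stack_cols[OF one_carrier_mat dA Y] dA by simp
    moreover have "?E *\<^sub>v stack_cols dY = stack_cols (A * dY)"
      using kron_mult_stack_cols[OF A dY one_carrier_mat] right_mult_one_mat[OF cY(2)] by simp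
    moreover have "?F *\<^sub>v stack_cols dY = stack_cols (transpose_mat Y * dY)"
      using kron_mult_stack_cols[of "transpose_mat Y" ?k m dY ?k "1\<^sub>m ?k" ?k] Y dY t by simp
    ultimately have "?N *\<^sub>v stack_pair (dA, dY) =
        stack_cols (dA * Y + A * dY) @\<^sub>v stack_cols (transpose_mat Y * dY)"
      using four_block_mat_mult_vec[OF D E zero_carrier_mat F vA vY] A Y
        zero_mat_mult_vec[OF vA, of "?k * ?k"] left_zero_vec[OF stack_cols_carrier[OF t]]
      by (simp add: constraint_mat_def Let_def stack_pair_def stack_cols_add[OF cY])
    also have "\<dots> = 0\<^sub>v (?k * n + ?k * ?k) \<longleftrightarrow>
        stack_cols (dA * Y + A * dY) = 0\<^sub>v (n * ?k) \<and>
        stack_cols (transpose_mat Y * dY) = 0\<^sub>v (?k * ?k)"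
    proof -
      have "0\<^sub>v (?k * n + ?k * ?k) = (0\<^sub>v (n * ?k) @\<^sub>v 0\<^sub>v (?k * ?k) :: real vec)"
        by (auto simp: mult.commute)
      then show ?thesis
        using append_vec_eq[OF stack_cols_carrier[OF s], of "0\<^sub>v (n * ?k)"] by simp
    qed
    also have "\<dots> \<longleftrightarrow> dA * Y + A * dY = 0\<^sub>m n ?k \<and> transpose_mat Y * dY = 0\<^sub>m ?k ?k"
      by (simp only: stack_cols_eq_zero_iff[OF s] stack_cols_eq_zero_iff[OF t])
    also have "\<dots> \<longleftrightarrow> (dA, dY) \<in> horizontal_space n m r A Y"
    proof -
      have tr: "transpose_mat dY * Y = transpose_mat (transpose_mat Y * dY)"
        using Y dY by (simp add: transpose_mult[of _ ?k m])
      have "transpose_mat Y * dY = 0\<^sub>m ?k ?k \<longleftrightarrow> transpose_mat dY * Y = 0\<^sub>m ?k ?k"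
        unfolding tr by (metis Matrix.transpose_transpose zero_transpose_mat)
      then show ?thesis
        using dA dY by (auto simp: horizontal_space_def tangent_space_def)
    qed
    finally show ?thesis .
  qed
  have N: "?N \<in> carrier_mat (?k * n + ?k * ?k) (m * n + ?k * m)"
    using A Y by (rule constraint_mat_carrier)
  show ?thesis
  proof
    show "stack_pair ` horizontal_space n m r A Y \<subseteq> kernel_vecs ?N"
    proof
      fix v assume "v \<in> stack_pair ` horizontal_space n m r A Y"
      then obtain dA dY where h: "(dA, dY) \<in> horizontal_space n m r A Y"
        and v: "v = stack_pair (dA, dY)" by auto
      then have c: "dA \<in> carrier_mat n m" "dY \<in> carrier_mat m ?k"
        by (auto simp: horizontal_space_def)
      have "v \<in> carrier_vec (m * n + ?k * m)"
        using stack_cols_carrier[OF c(1)] stack_cols_carrier[OF c(2)]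
        by (auto simp: v stack_pair_def mult.commute)
      then show "v \<in> kernel_vecs ?N"
        using N key[OF c] h v by (auto simp: kernel_vecs_def)
    qed
    show "kernel_vecs ?N \<subseteq> stack_pair ` horizontal_space n m r A Y"
    proof
      fix v assume "v \<in> kernel_vecs ?N"
      then have v: "v \<in> carrier_vec (n * m + m * ?k)" "?N *\<^sub>v v = 0\<^sub>v (?k * n + ?k * ?k)"
        using N by (auto simp: kernel_vecs_def mult.commute)
      obtain dA where dA: "dA \<in> carrier_mat n m" "stack_cols dA = vec_first v (n * m)"
        by (rule stack_cols_unstack[OF vec_first_carrier])
      obtain dY where dY: "dY \<in> carrier_mat m ?k" "stack_cols dY = vec_last v (m * ?k)"
        by (rule stack_cols_unstack[OF vec_last_carrier])
      have "v = stack_pair (dA, dY)"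
        using vec_first_last_append[OF v(1)] dA dY by (simp add: stack_pair_def)
      then show "v \<in> stack_pair ` horizontal_space n m r A Y"
        using key[OF dA(1) dY(1)] v(2) by blast
    qed
  qed
qed

text \<open>For \<open>x = (u, w)\<close> the vector \<open>N\<^sup>T x\<close> is \<open>(D\<^sup>T u, E\<^sup>T u + F\<^sup>T w)\<close>. Here \<open>D\<^sup>T\<close> and \<open>F\<^sup>T\<close>
  are isometries and the two summands in the second component are orthogonal, so the squared length is
  that of \<open>x\<close> plus that of \<open>E\<^sup>T u\<close>.\<close>

lemma block_rows_coercive:
  fixes D E F :: "real mat"
  assumes D: "D \<in> carrier_mat p a" and E: "E \<in> carrier_mat p b" and F: "F \<in> carrier_mat q b"
    and DD: "D * transpose_mat D = 1\<^sub>m p" and FF: "F * transpose_mat F = 1\<^sub>m q"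
    and EF: "E * transpose_mat F = 0\<^sub>m p q"
    and x: "x \<in> carrier_vec (p + q)"
  defines "N \<equiv> four_block_mat D E (0\<^sub>m q a) F"
  shows "x \<bullet> x \<le> (transpose_mat N *\<^sub>v x) \<bullet> (transpose_mat N *\<^sub>v x)"
proof -
  define u where "u = vec_first x p"
  define w where "w = vec_last x q"
  have u: "u \<in> carrier_vec p" and w: "w \<in> carrier_vec q" and x_eq: "x = u @\<^sub>v w"
    using x by (auto simp: u_def w_def)
  have DT: "transpose_mat D \<in> carrier_mat a p" and ET: "transpose_mat E \<in> carrier_mat b p"
    and FT: "transpose_mat F \<in> carrier_mat b q"
    using D E F by auto
  let ?d = "transpose_mat D *\<^sub>v u" and ?e = "transpose_mat E *\<^sub>v u"
    and ?f = "transpose_mat F *\<^sub>v w"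
  have d: "?d \<in> carrier_vec a" and e: "?e \<in> carrier_vec b" and f: "?f \<in> carrier_vec b"
    using D E F u w by auto
  have "transpose_mat N = four_block_mat (transpose_mat D) (0\<^sub>m a q) (transpose_mat E) (transpose_mat F)"
    unfolding N_def using transpose_four_block_mat[OF D E zero_carrier_mat F] by simp
  then have "transpose_mat N *\<^sub>v x = ?d @\<^sub>v (?e + ?f)"
    using four_block_mat_mult_vec[OF DT zero_carrier_mat ET FT u w] d
      zero_mat_mult_vec[OF w, of a] right_zero_vec[OF d] by (simp add: x_eq)
  then have "(transpose_mat N *\<^sub>v x) \<bullet> (transpose_mat N *\<^sub>v x) =
      ?d \<bullet> ?d + (?e + ?f) \<bullet> (?e + ?f)"
    using d e f by (simp add: scalar_prod_append[of _ a _ b])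
  also have "(?e + ?f) \<bullet> (?e + ?f) = ?e \<bullet> ?e + 2 * (?e \<bullet> ?f) + ?f \<bullet> ?f"
    using e f comm_scalar_prod[OF e f]
    by (simp add: add_scalar_prod_distrib[of _ b] scalar_prod_add_distrib[of _ b])
  also have "?d \<bullet> ?d = u \<bullet> u"
    using transpose_vec_mult_scalar[OF D d u] assoc_mult_mat_vec[OF D DT u] DD u by simp
  also have "?e \<bullet> ?f = 0"
    using transpose_vec_mult_scalar[OF E f u] assoc_mult_mat_vec[OF E FT w, symmetric] EF u
      zero_mat_mult_vec[OF w, of p] by simp
  also have "?f \<bullet> ?f = w \<bullet> w"
    using transpose_vec_mult_scalar[OF F f w] assoc_mult_mat_vec[OF F FT w] FF w by simp
  finally show ?thesis
    using u w real_scalar_prod_self_nonneg[of ?e] by (simp add: x_eq scalar_prod_append[of _ p _ q])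
qed

text \<open>The orthonormality of the columns of \<open>Y\<close> and the equation \<open>A Y = 0\<close> pass to the Kronecker
  blocks by the mixed product rule.\<close>

lemma constraint_mat_coercive:
  assumes A: "A \<in> carrier_mat n m" and Y: "Y \<in> carrier_mat m k"
    and AY: "A * Y = 0\<^sub>m n k" and YY: "transpose_mat Y * Y = 1\<^sub>m k"
    and x: "x \<in> carrier_vec (k * n + k * k)"
  shows "x \<bullet> x \<le> (transpose_mat (constraint_mat A Y) *\<^sub>v x) \<bullet>
    (transpose_mat (constraint_mat A Y) *\<^sub>v x)"
proof -
  have YT: "transpose_mat Y \<in> carrier_mat k m" using Y by auto
  let ?D = "kron (transpose_mat Y) (1\<^sub>m n)" and ?E = "kron (1\<^sub>m k) A"
    and ?F = "kron (1\<^sub>m k) (transpose_mat Y)"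
  have D: "?D \<in> carrier_mat (k * n) (m * n)" and E: "?E \<in> carrier_mat (k * n) (k * m)"
    and F: "?F \<in> carrier_mat (k * k) (k * m)"
    using A Y by (auto intro!: kron_carrier)
  have "?D * transpose_mat ?D = 1\<^sub>m (k * n)"
    using kron_mult[OF YT one_carrier_mat Y one_carrier_mat] YY
    by (simp add: kron_transpose kron_one)
  moreover have "?F * transpose_mat ?F = 1\<^sub>m (k * k)"
    using kron_mult[OF one_carrier_mat YT one_carrier_mat Y] YY
    by (simp add: kron_transpose kron_one)
  moreover have "?E * transpose_mat ?F = 0\<^sub>m (k * n) (k * k)"
    using kron_mult[OF one_carrier_mat A one_carrier_mat Y] AY
    by (simp add: kron_transpose kron_zero_right[OF one_carrier_mat])
  ultimately show ?thesis
    using block_rows_coercive[OF D E F _ _ _ x] A Y by (simp add: constraint_mat_def)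
qed

lemma frob_norm_four_block_upper:
  assumes D: "D \<in> carrier_mat p a" and E: "E \<in> carrier_mat p b" and F: "F \<in> carrier_mat q b"
  shows "(frob_norm (four_block_mat D E (0\<^sub>m q a) F))\<^sup>2 =
    (frob_norm D)\<^sup>2 + (frob_norm E)\<^sup>2 + (frob_norm F)\<^sup>2"
proof -
  have split: "(\<Sum>i<s + t. g i) = (\<Sum>i<s. g i) + (\<Sum>i<t. g (s + i))" for g :: "nat \<Rightarrow> real" and s t
    by (induction t) auto
  show ?thesis
    unfolding frob_norm_power2 using D E F by (simp add: split sum.distrib)
qed

lemma frob_norm_constraint_mat_diff:
  assumes A: "A \<in> carrier_mat n m" and A': "A' \<in> carrier_mat n m"
    and Y: "Y \<in> carrier_mat m k" and Y': "Y' \<in> carrier_mat m k"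
  shows "(frob_norm (constraint_mat A Y - constraint_mat A' Y'))\<^sup>2 =
    real n * (frob_norm (Y - Y'))\<^sup>2 + real k * ((frob_norm (A - A'))\<^sup>2 + (frob_norm (Y - Y'))\<^sup>2)"
proof -
  let ?T = "transpose_mat (Y - Y')"
  have T: "?T = transpose_mat Y - transpose_mat Y'"
    using Y Y' by (simp add: transpose_minus)
  let ?D = "kron ?T (1\<^sub>m n)" and ?E = "kron (1\<^sub>m k) (A - A')" and ?F = "kron (1\<^sub>m k) ?T"
  have YT: "transpose_mat Y \<in> carrier_mat k m" "transpose_mat Y' \<in> carrier_mat k m"
    using Y Y' by auto
  have D: "?D \<in> carrier_mat (k * n) (m * n)" and E: "?E \<in> carrier_mat (k * n) (k * m)"
    and F: "?F \<in> carrier_mat (k * k) (k * m)"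
    using A A' Y Y' by (auto intro!: kron_carrier)
  have "constraint_mat A Y - constraint_mat A' Y' = four_block_mat ?D ?E (0\<^sub>m (k * k) (m * n)) ?F"
    unfolding T kron_minus_left[OF YT] kron_minus_right[OF YT] kron_minus_right[OF A A']
    using A A' Y Y' by (intro eq_matI) (auto simp: constraint_mat_def Let_def kron_def)
  then show ?thesis
    using frob_norm_four_block_upper[OF D E F]
    by (simp add: frob_norm_kron frob_norm_one frob_norm_transpose algebra_simps)
qed

theorem theorem2p4:
  fixes n m r :: nat and A Y A' Y' :: "real mat"
  assumes "n \<ge> 1" and "m \<ge> 1" and "r \<le> m"
    and "(A, Y) \<in> M_tot n m r" and "(A', Y') \<in> M_tot n m r"
  shows "frob_norm (horizontal_proj n m r A Y - horizontal_proj n m r A' Y')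
           \<le> 2 * (sqrt (real n) + sqrt (real (m - r))) * (frob_norm (A - A') + frob_norm (Y - Y'))"
proof -
  define k where "k = m - r"
  have AY: "A \<in> carrier_mat n m" "Y \<in> carrier_mat m k" "A * Y = 0\<^sub>m n k"
      "transpose_mat Y * Y = 1\<^sub>m k"
    and AY': "A' \<in> carrier_mat n m" "Y' \<in> carrier_mat m k" "A' * Y' = 0\<^sub>m n k"
      "transpose_mat Y' * Y' = 1\<^sub>m k"
    using assms(4,5) by (auto simp: M_tot_def k_def)
  let ?N = "constraint_mat A Y" and ?N' = "constraint_mat A' Y'"
  define a where "a = frob_norm (A - A')"
  define y where "y = frob_norm (Y - Y')"
  define s where "s = sqrt (real n)"
  define t where "t = sqrt (real k)"
  have nonneg: "0 \<le> a" "0 \<le> y" "0 \<le> s" "0 \<le> t" and n: "real n = s\<^sup>2" and k: "real k = t\<^sup>2"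
    by (auto simp: a_def y_def s_def t_def frob_norm_nonneg)
  have "frob_norm (horizontal_proj n m r A Y - horizontal_proj n m r A' Y')
      \<le> 2 * frob_norm (?N - ?N')"
    using kernel_projection_lipschitz[OF constraint_mat_carrier[OF AY(1,2)]
        constraint_mat_carrier[OF AY'(1,2)] constraint_mat_coercive[OF AY] constraint_mat_coercive[OF AY']]
      constraint_mat_kernel[of A n m Y r] constraint_mat_kernel[of A' n m Y' r] AY AY'
    by (simp add: horizontal_proj_def k_def mult.commute)
  also have "frob_norm (?N - ?N') \<le> (s + t) * (a + y)"
  proof (rule power2_le_imp_le)
    have "(frob_norm (?N - ?N'))\<^sup>2 = s\<^sup>2 * y\<^sup>2 + t\<^sup>2 * (a\<^sup>2 + y\<^sup>2)"
      using frob_norm_constraint_mat_diff[OF AY(1) AY'(1) AY(2) AY'(2)]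
      by (simp add: a_def y_def n k)
    also have "\<dots> \<le> s\<^sup>2 * (a + y)\<^sup>2 + t\<^sup>2 * (a + y)\<^sup>2"
      using nonneg by (intro add_mono mult_left_mono) (auto simp: power2_sum)
    also have "\<dots> \<le> ((s + t) * (a + y))\<^sup>2"
      using nonneg unfolding power_mult_distrib
      by (simp add: power2_sum[of s t] distrib_right[symmetric] mult_right_mono)
    finally show "(frob_norm (?N - ?N'))\<^sup>2 \<le> ((s + t) * (a + y))\<^sup>2" .
  qed (use nonneg in simp)
  finally show ?thesis
    by (simp add: a_def y_def s_def t_def k_def algebra_simps)
qed

end
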